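(* Let the smoothness-ABG assumption (with $A,B\ge0$) hold and suppose that $f$ satisfies the Polyak-Łojasiewicz condition: there is $\gamma>0$ such that $\|\nabla f(x)\|^2\ge\gamma(f(x)-f^* )$ for all $x\in\mathbb R^d$. Let $\bar\alpha>0$, $h>0$, $1/2<\theta<1$, and choose $\alpha_k=\bar\alpha(k+1)^{-\theta}$ and $h_k=h(k+1)^{-\theta/2}$. If $A+\gamma B>0$, let $\bar\alpha$ be such that $2\bar\alpha\lambda d(A+\gamma B)=\gamma l\eta$ for some $0\le\eta<1$; if $A=B=0$, $\bar\alpha>0$ is arbitrary and $\eta:=0$. Let $(x_k)$ be generated by S-SZD from a deterministic $x_0\in\mathbb R^d$ and $f_k:=f(x_k)$. Then, as $k\to+\infty$, $$\mathbb E[f_k-f^*]\le\frac{2\lambda d}{\gamma l(1-\eta)}\left[G\bar\alpha+\frac{h^2\lambda d}{8}+\frac{h^2\lambda^2d^2\bar\alpha}{4l}\right](k+1)^{-\theta}+o\big((k+1)^{-\theta}\big).$$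
   Context: Setting. $1\le l\le d$ are integers, $\|\cdot\|$ is the Euclidean norm. $Z$ is a random variable with values in a measurable space $\mathcal Z$, $F:\mathbb R^d\times\mathcal Z\to\mathbb R$, $f(x):=\mathbb E[F(x,Z)]$, $f^*:=\inf f$, and $\nabla$ denotes the gradient in the variable $x$. Smoothness-ABG assumption. (i) There is $\lambda>0$ such that for every $z\in\mathcal Z$ the function $x\mapsto F(x,z)$ is differentiable with $\lambda$-Lipschitz gradient. (ii) $f(x)<+\infty$ for every $x\in\mathbb R^d$, $f$ is differentiable and has at least one minimizer. (iii) There are constants $A,B\ge0$, $G>0$ such that for every $x\in\mathbb R^d$, $\mathbb E[\|\nabla F(x,Z)\|^2]\le A(f(x)-f^* )+B\|\nabla f(x)\|^2+G$. Algorithm S-SZD. $(Z_k)_{k\in\mathbb N}$ are independent copies of $Z$. $(P_k)_{k\in\mathbb N}$ are random $d\times l$ matrices, each satisfying $\mathbb E[P_kP_k^\intercal]=I$ and $P_k^\intercal P_k=\frac dl I$ almost surely; all the $P_k$ and $Z_k$ are mutually independent. With $p_k^{(i)}$ the $i$-th column of $P_k$, the iteration is $$x_{k+1}=x_k-\alpha_k\sum_{i=1}^l\frac{F(x_k+h_kp_k^{(i)},Z_k)-F(x_k,Z_k)}{h_k}\,p_k^{(i)},\qquad k=0,1,2,\dots$$ *)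

theory Defs
  imports "HOL-Probability.Probability" "HOL-Library.Landau_Symbols"
begin

definition gradient :: "('a::real_inner \<Rightarrow> real) \<Rightarrow> 'a \<Rightarrow> 'a" where
  "gradient f x = (THE D. GDERIV f x :> D)"

lemma gradient_eqI:
  assumes "GDERIV f x :> D"
  shows "gradient f x = D"
proof -
  have "E = D" if "GDERIV f x :> E" for E
  proof -
    have "(\<lambda>h. h \<bullet> E) = (\<lambda>h. h \<bullet> D)"
      using that assms unfolding gderiv_def by (rule has_derivative_unique)
    then have "(E - D) \<bullet> (E - D) = 0"
      by (metis inner_diff_right right_minus_eq)
    then show ?thesis by simp
  qed
  with assms show ?thesis unfolding gradient_def by blast
qed

definition objective :: "'w measure \<Rightarrow> ('w \<Rightarrow> 'z) \<Rightarrow> ('x \<Rightarrow> 'z \<Rightarrow> real) \<Rightarrow> 'x \<Rightarrow> real" where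
  "objective M Z F x = prob_space.expectation M (\<lambda>\<omega>. F x (Z \<omega>))"

text \<open>The measure \<open>S\<close> only serves as the measurable space in which \<open>Z\<close> takes its values.
  Since the Bochner integral of a non-integrable function is \<open>0\<close>, finiteness of the two
  expectations is stated as integrability.\<close>

definition smoothness_ABG ::
  "'w measure \<Rightarrow> 'z measure \<Rightarrow> ('w \<Rightarrow> 'z) \<Rightarrow> ('x::euclidean_space \<Rightarrow> 'z \<Rightarrow> real)
    \<Rightarrow> real \<Rightarrow> real \<Rightarrow> real \<Rightarrow> real \<Rightarrow> bool" where
  "smoothness_ABG M S Z F lam A B G \<longleftrightarrow>
    (let f = objective M Z F in
      lam > 0 \<and>
      (\<forall>z\<in>space S. (\<forall>x. (\<lambda>y. F y z) differentiable (at x)) \<and>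
         lam-lipschitz_on UNIV (gradient (\<lambda>y. F y z))) \<and>
      (\<forall>x. integrable M (\<lambda>\<omega>. F x (Z \<omega>))) \<and>
      (\<forall>x. f differentiable (at x)) \<and>
      (\<exists>x. \<forall>y. f x \<le> f y) \<and>
      A \<ge> 0 \<and> B \<ge> 0 \<and> G > 0 \<and>
      (\<forall>x. integrable M (\<lambda>\<omega>. (norm (gradient (\<lambda>y. F y (Z \<omega>)) x))\<^sup>2) \<and>
         prob_space.expectation M (\<lambda>\<omega>. (norm (gradient (\<lambda>y. F y (Z \<omega>)) x))\<^sup>2)
           \<le> A * (f x - (INF y. f y)) + B * (norm (gradient f x))\<^sup>2 + G))"

definition polyak_lojasiewicz :: "('x::real_inner \<Rightarrow> real) \<Rightarrow> real \<Rightarrow> bool" where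
  "polyak_lojasiewicz f \<gamma> \<longleftrightarrow>
    \<gamma> > 0 \<and> (\<forall>x. (norm (gradient f x))\<^sup>2 \<ge> \<gamma> * (f x - (INF y. f y)))"

text \<open>\<open>indep_vars\<close> requires all variables to have values in one type. As \<open>P k\<close> and \<open>Zs k\<close>
  do not, joint independence of the two families is stated, as in \<open>indep_vars_def2\<close>, by
  independence of the generated \<open>\<sigma>\<close>-algebras, indexed by a sum type.\<close>

definition szd_sampling ::
  "'w measure \<Rightarrow> 'z measure \<Rightarrow> ('w \<Rightarrow> 'z) \<Rightarrow> (nat \<Rightarrow> 'w \<Rightarrow> 'z)
    \<Rightarrow> (nat \<Rightarrow> 'w \<Rightarrow> real ^ 'l::finite ^ 'd::finite) \<Rightarrow> bool" where
  "szd_sampling M S Z Zs P \<longleftrightarrow>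
    (\<forall>k. Zs k \<in> measurable M S \<and> distr M S (Zs k) = distr M S Z) \<and>
    (\<forall>k. P k \<in> borel_measurable M \<and>
       prob_space.expectation M (\<lambda>\<omega>. P k \<omega> ** transpose (P k \<omega>)) = mat 1 \<and>
       (AE \<omega> in M. transpose (P k \<omega>) ** P k \<omega> = (real CARD('d) / real CARD('l)) *\<^sub>R mat 1)) \<and>
    prob_space.indep_sets M
      (\<lambda>j. case j of
          Inl k \<Rightarrow> {P k -` C \<inter> space M | C. C \<in> sets borel}
        | Inr k \<Rightarrow> {Zs k -` C \<inter> space M | C. C \<in> sets S})
      (UNIV :: (nat + nat) set)"

primrec s_szd ::
  "(real ^ 'd \<Rightarrow> 'z \<Rightarrow> real) \<Rightarrow> (nat \<Rightarrow> real) \<Rightarrow> (nat \<Rightarrow> real)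
    \<Rightarrow> (nat \<Rightarrow> 'w \<Rightarrow> real ^ 'l::finite ^ 'd::finite) \<Rightarrow> (nat \<Rightarrow> 'w \<Rightarrow> 'z)
    \<Rightarrow> real ^ 'd \<Rightarrow> nat \<Rightarrow> 'w \<Rightarrow> real ^ 'd" where
  "s_szd F \<alpha> h P Zs x0 0 \<omega> = x0"
| "s_szd F \<alpha> h P Zs x0 (Suc k) \<omega> =
    (let x = s_szd F \<alpha> h P Zs x0 k \<omega> in
      x - \<alpha> k *\<^sub>R (\<Sum>i\<in>UNIV.
        ((F (x + h k *\<^sub>R column i (P k \<omega>)) (Zs k \<omega>) - F x (Zs k \<omega>)) / h k)
          *\<^sub>R column i (P k \<omega>)))"

end

theory Submission
  imports Defs "HOL-Real_Asymp.Real_Asymp"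
begin

text \<open>
  Orthogonality of the columns of \<open>P\<^sub>k\<close> gives the exact identity \<open>\<parallel>P\<^sub>k c\<parallel>\<^sup>2 = (d/l) \<parallel>c\<parallel>\<^sup>2\<close>, so that the
  finite-difference direction is \<open>P P\<^sup>T \<nabla>F + P e\<close> with \<open>\<bar>e\<^sub>i\<bar> \<le> \<lambda> h d / (2 l)\<close>. Inserting this into the descent
  lemma for \<open>f\<close> and averaging first over \<open>P\<^sub>k\<close>, then over \<open>Z\<^sub>k\<close>, which are independent of the
  past, the ABG and Polyak-Lojasiewicz inequalities yield
  \<open>u\<^sub>k\<^sub>+\<^sub>1 \<le> (1 - c (k+1)\<^sup>-\<^sup>\<theta>) u\<^sub>k + b (k+1)\<^sup>-\<^sup>2\<^sup>\<theta>\<close> for \<open>u\<^sub>k = E[f\<^sub>k - f\<^sup>*]\<close>. By Chung's lemma the limit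
  superior of \<open>(k+1)\<^sup>\<theta> u\<^sub>k\<close> is at most \<open>b/c\<close>, the constant of the claim.
\<close>

section \<open>Gradients and the descent lemma\<close>

text \<open>In finite dimension the derivative is represented by the vector of its values on
  \<open>Basis\<close>. This gives the definite description in \<open>gradient\<close> a denotation,
  so that differentiability can be used through \<open>GDERIV\<close>.\<close>

lemma differentiable_imp_GDERIV:
  fixes f :: "'a::euclidean_space \<Rightarrow> real"
  assumes "f differentiable (at x)"
  shows "GDERIV f x :> gradient f x"
proof -
  obtain f' where f': "(f has_derivative f') (at x)"
    using assms unfolding differentiable_def by blast
  then interpret linear f' by (rule has_derivative_linear)
  have "f' = (\<lambda>h. h \<bullet> (\<Sum>b\<in>Basis. f' b *\<^sub>R b))"
  proof
    fix h
    have "f' h = f' (\<Sum>b\<in>Basis. (h \<bullet> b) *\<^sub>R b)"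
      by (simp add: euclidean_representation)
    then show "f' h = h \<bullet> (\<Sum>b\<in>Basis. f' b *\<^sub>R b)"
      by (simp add: sum scaleR inner_sum_right mult.commute)
  qed
  with f' have "GDERIV f x :> (\<Sum>b\<in>Basis. f' b *\<^sub>R b)"
    unfolding gderiv_def by simp
  then show ?thesis
    using gradient_eqI by metis
qed

text \<open>Up to a constant, \<open>\<phi>\<close> is the deviation from the quadratic model along
  the segment from \<open>x\<close> to \<open>x + v\<close>. Its derivative is nonpositive by
  Cauchy-Schwarz and the Lipschitz bound, so comparing \<open>\<phi> 1\<close> with
  \<open>\<phi> 0\<close> replaces an integral of the gradient.\<close>

lemma Lipschitz_gradient_upper_bound:
  fixes f :: "'a::euclidean_space \<Rightarrow> real"
  assumes g: "\<And>y. GDERIV f y :> g y" and lip: "L-lipschitz_on UNIV g"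
  shows "f (x + v) - f x - g x \<bullet> v \<le> L / 2 * (norm v)\<^sup>2"
proof -
  define \<phi> where "\<phi> t = f (x + t *\<^sub>R v) - t * (g x \<bullet> v) - L / 2 * t\<^sup>2 * (norm v)\<^sup>2" for t
  have D: "DERIV \<phi> t :> v \<bullet> g (x + t *\<^sub>R v) - g x \<bullet> v - L * t * (norm v)\<^sup>2" for t
  proof -
    have "((\<lambda>t. f (x + t *\<^sub>R v)) has_derivative (\<lambda>s. (s *\<^sub>R v) \<bullet> g (x + t *\<^sub>R v))) (at t)"
      using g[of "x + t *\<^sub>R v"] unfolding gderiv_def
      by (rule has_derivative_compose[rotated]) (auto intro!: derivative_eq_intros)
    then have "((\<lambda>t. f (x + t *\<^sub>R v)) has_field_derivative v \<bullet> g (x + t *\<^sub>R v)) (at t)"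
      by (simp add: has_field_derivative_def mult_commute_abs)
    then show ?thesis
      unfolding \<phi>_def by (auto intro!: derivative_eq_intros simp: power2_eq_square)
  qed
  have "v \<bullet> g (x + t *\<^sub>R v) - g x \<bullet> v - L * t * (norm v)\<^sup>2 \<le> 0" if "0 \<le> t" for t
  proof -
    have "v \<bullet> g (x + t *\<^sub>R v) - g x \<bullet> v = v \<bullet> (g (x + t *\<^sub>R v) - g x)"
      by (simp add: inner_diff_right inner_commute)
    also have "\<dots> \<le> norm v * norm (g (x + t *\<^sub>R v) - g x)"
      by (rule norm_cauchy_schwarz)
    also have "\<dots> \<le> norm v * (L * norm (t *\<^sub>R v))"
      using lipschitz_onD[OF lip, of "x + t *\<^sub>R v" x]
      by (intro mult_left_mono) (auto simp: dist_norm)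
    also have "\<dots> = L * t * (norm v)\<^sup>2"
      using that by (simp add: power2_eq_square)
    finally show ?thesis by simp
  qed
  with D have "\<exists>r. DERIV \<phi> t :> r \<and> r \<le> 0" if "0 \<le> t" for t
    using that by meson
  then have "\<phi> 1 \<le> \<phi> 0"
    by (intro DERIV_nonpos_imp_nonincreasing[of 0 1]) auto
  then show ?thesis
    by (simp add: \<phi>_def)
qed

lemma Lipschitz_gradient_abs_bound:
  fixes f :: "'a::euclidean_space \<Rightarrow> real"
  assumes "\<And>y. GDERIV f y :> g y" and lip: "L-lipschitz_on UNIV g"
  shows "\<bar>f (x + v) - f x - g x \<bullet> v\<bar> \<le> L / 2 * (norm v)\<^sup>2"
proof -
  \<comment> \<open>The lower estimate is the upper one for \<open>- f\<close>, whose gradient has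
    the same Lipschitz constant.\<close>
  have "\<And>y. GDERIV (\<lambda>y. - f y) y :> - g y" "L-lipschitz_on UNIV (\<lambda>y. - g y)"
    using assms by (auto intro: GDERIV_minus lipschitz_on_minus)
  then have "- (f (x + v) - f x - g x \<bullet> v) \<le> L / 2 * (norm v)\<^sup>2"
    using Lipschitz_gradient_upper_bound[of "\<lambda>y. - f y" "\<lambda>y. - g y" L x v] by simp
  then show ?thesis
    using Lipschitz_gradient_upper_bound[OF assms, of x v] by (rule abs_leI[rotated])
qed

section \<open>Joint measurability and independence\<close>

text \<open>The identity in the first argument is a limit of maps \<open>s i\<close> with finite
  range. For each of them only finitely many sections of \<open>F\<close> occur, and continuity
  carries measurability to the limit. The algorithm needs this because it evaluates \<open>F\<close>
  at random points.\<close>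

lemma measurable_Caratheodory:
  fixes F :: "'a::{metric_space, second_countable_topology} \<Rightarrow> 'z \<Rightarrow> 'b::metric_space"
  assumes meas: "\<And>y. F y \<in> borel_measurable S"
    and cont: "\<And>z. z \<in> space S \<Longrightarrow> continuous_on UNIV (\<lambda>y. F y z)"
  shows "(\<lambda>(y, z). F y z) \<in> borel_measurable (borel \<Otimes>\<^sub>M S)"
proof -
  have "(\<lambda>y::'a. y) \<in> borel_measurable borel" by simp
  from borel_measurable_implies_sequence_metric[OF this, of undefined]
  obtain s :: "nat \<Rightarrow> 'a \<Rightarrow> 'a"
    where s: "\<And>i. simple_function borel (s i)" and lim: "\<And>y. (\<lambda>i. s i y) \<longlonglongrightarrow> y"
    by auto
  show ?thesis
  proof (rule borel_measurable_LIMSEQ_metric)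
    fix i
    have "(\<lambda>w. F (s i (fst w)) (snd w)) \<in> borel_measurable (borel \<Otimes>\<^sub>M S)"
    proof (rule measurable_compose_countable'[where I = "range (s i)"
        and f = "\<lambda>y w. F y (snd w)"])
      show "(\<lambda>w. s i (fst w)) \<in> borel \<Otimes>\<^sub>M S \<rightarrow>\<^sub>M count_space (range (s i))"
        using measurable_simple_function[OF s[of i]] simple_functionD(1)[OF s[of i]]
        by (intro measurable_compose[OF measurable_fst]) (auto simp: measurable_count_space_eq2 simple_function_def intro: simple_functionD(2)[OF s[of i], simplified])
      show "countable (range (s i))"
        using simple_functionD(1)[OF s[of i]] by (simp add: countable_finite)
    qed (auto intro: measurable_compose[OF measurable_snd meas])
    then show "(\<lambda>(y, z). F (s i y) z) \<in> borel_measurable (borel \<Otimes>\<^sub>M S)"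
      by (simp add: case_prod_beta')
  next
    fix w assume "w \<in> space ((borel :: 'a measure) \<Otimes>\<^sub>M S)"
    then have "snd w \<in> space S" by (auto simp: space_pair_measure)
    from continuous_on_tendsto_compose[OF cont[OF this] lim]
    show "(\<lambda>i. case w of (y, z) \<Rightarrow> F (s i y) z) \<longlonglongrightarrow> (case w of (y, z) \<Rightarrow> F y z)"
      by (auto simp: case_prod_beta')
  qed
qed

text \<open>Disjoint groups of independent generators produce independent \<sigma>-algebras, so the
  joint law factorises on rectangles, which determine it. It serves to separate the past from the
  current draws, and then \<open>Zs k\<close> from \<open>P k\<close>.\<close>

lemma (in prob_space) distr_Pair_indep_sigma:
  assumes indep: "indep_sets E UNIV" and Int: "\<And>i. Int_stable (E i)" and disj: "K \<inter> L = {}"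
    and X: "X \<in> measurable (sigma (space M) (\<Union>i\<in>K. E i)) A"
    and Y: "Y \<in> measurable (sigma (space M) (\<Union>i\<in>L. E i)) B"
  shows "distr M (A \<Otimes>\<^sub>M B) (\<lambda>\<omega>. (X \<omega>, Y \<omega>)) = distr M A X \<Otimes>\<^sub>M distr M B Y"
proof -
  have ev: "E i \<subseteq> events" for i
    using indep unfolding indep_sets_def by auto
  then have sub: "(\<Union>i\<in>J. E i) \<subseteq> Pow (space M)" for J
    using sets.space_closed by blast
  have sub_events: "sigma_sets (space M) (\<Union>i\<in>J. E i) \<subseteq> events" for J
    using ev by (intro sets.sigma_sets_subset) auto
  have XM: "X \<in> measurable M A"
    using X sub_events[of K] by (intro measurable_mono[THEN subsetD, OF _ _ _ _ X]) (auto simp: sub)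
  have YM: "Y \<in> measurable M B"
    using Y sub_events[of L] by (intro measurable_mono[THEN subsetD, OF _ _ _ _ Y]) (auto simp: sub)
  have "indep_sets (\<lambda>j. sigma_sets (space M) (\<Union>i\<in>case_bool K L j. E i)) UNIV"
    using indep Int disj
    by (intro indep_sets_collect_sigma)
       (auto intro: indep_sets_mono_index simp: disjoint_family_on_def split: bool.split)
  also have "(\<lambda>j. sigma_sets (space M) (\<Union>i\<in>case_bool K L j. E i)) =
      case_bool (sigma_sets (space M) (\<Union>i\<in>K. E i)) (sigma_sets (space M) (\<Union>i\<in>L. E i))"
    by (rule ext) (simp split: bool.split)
  finally have I: "indep_set (sigma_sets (space M) (\<Union>i\<in>K. E i)) (sigma_sets (space M) (\<Union>i\<in>L. E i))"
    unfolding indep_set_def .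
  interpret DX: prob_space "distr M A X" using XM by (rule prob_space_distr)
  interpret DY: prob_space "distr M B Y" using YM by (rule prob_space_distr)
  show ?thesis
  proof (rule pair_measure_eqI[symmetric])
    fix a b assume ab: "a \<in> sets (distr M A X)" "b \<in> sets (distr M B Y)"
    have "X -` a \<inter> space M \<in> sigma_sets (space M) (\<Union>i\<in>K. E i)"
      "Y -` b \<inter> space M \<in> sigma_sets (space M) (\<Union>i\<in>L. E i)"
      using measurable_sets[OF X] measurable_sets[OF Y] ab by (auto simp: sub space_measure_of_conv)
    from indep_setD[OF I this]
    have "prob (X -` a \<inter> space M \<inter> (Y -` b \<inter> space M)) =
      prob (X -` a \<inter> space M) * prob (Y -` b \<inter> space M)" .
    moreover have "(\<lambda>\<omega>. (X \<omega>, Y \<omega>)) -` (a \<times> b) \<inter> space M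
        = X -` a \<inter> space M \<inter> (Y -` b \<inter> space M)"
      by auto
    ultimately show "emeasure (distr M A X) a * emeasure (distr M B Y) b =
      emeasure (distr M (A \<Otimes>\<^sub>M B) (\<lambda>\<omega>. (X \<omega>, Y \<omega>))) (a \<times> b)"
      using ab XM YM
      by (simp add: emeasure_distr emeasure_eq_measure ennreal_mult)
  qed (auto intro: DX.sigma_finite_measure_axioms DY.sigma_finite_measure_axioms)
qed

section \<open>Scalar recurrences and Chung's lemma\<close>

text \<open>Each step moves \<open>y\<close> towards a target at most \<open>\<beta>0\<close> with
  weight \<open>a k\<close>. The excess over \<open>\<beta>0\<close> therefore shrinks by
  \<open>1 - a k \<le> exp (- a k)\<close>, and the divergent sum of weights drives it to
  zero.\<close>

lemma scaled_recurrence_eventually_le: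
  fixes y a \<beta> :: "nat \<Rightarrow> real"
  assumes rec: "\<And>k. N \<le> k \<Longrightarrow> y (Suc k) \<le> (1 - a k) * y k + a k * \<beta> k"
    and a: "\<And>k. N \<le> k \<Longrightarrow> 0 \<le> a k \<and> a k \<le> 1"
    and div: "\<not> summable a" and \<beta>: "\<And>k. N \<le> k \<Longrightarrow> \<beta> k \<le> \<beta>0" and \<epsilon>: "0 < \<epsilon>"
  shows "eventually (\<lambda>k. y k \<le> \<beta>0 + \<epsilon>) sequentially"
proof -
  \<comment> \<open>The maximum with \<open>0\<close> covers a start below \<open>\<beta>0\<close>
    and keeps the factor of the exponential nonnegative.\<close>
  define c where "c = max 0 (y N - \<beta>0)"
  have le: "y (N + n) - \<beta>0 \<le> c * exp (- (\<Sum>j<n. a (N + j)))" for n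
  proof (induction n)
    case (Suc n)
    have aN: "0 \<le> a (N + n)" "a (N + n) \<le> 1" using a by auto
    have "a (N + n) * \<beta> (N + n) \<le> a (N + n) * \<beta>0"
      using aN \<beta>[of "N + n"] by (intro mult_left_mono) auto
    then have "y (N + Suc n) - \<beta>0 \<le> (1 - a (N + n)) * (y (N + n) - \<beta>0)"
      using rec[of "N + n"] by (simp add: algebra_simps)
    also have "\<dots> \<le> (1 - a (N + n)) * (c * exp (- (\<Sum>j<n. a (N + j))))"
      using aN Suc by (intro mult_left_mono) auto
    also have "\<dots> \<le> exp (- a (N + n)) * (c * exp (- (\<Sum>j<n. a (N + j))))"
      using exp_ge_add_one_self[of "- a (N + n)"]
      by (intro mult_right_mono) (auto simp: c_def)
    also have "\<dots> = c * exp (- (\<Sum>j<Suc n. a (N + j)))"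
      by (simp add: exp_add[symmetric] algebra_simps)
    finally show ?case .
  qed (simp add: c_def)
  have "\<not> summable (\<lambda>j. a (N + j))"
    using div summable_iff_shift[of a N] by (simp add: add.commute)
  have "filterlim (\<lambda>n. \<Sum>j<n. a (N + j)) at_top sequentially"
  proof (rule filterlim_at_top[THEN iffD2], intro allI)
    fix C
    have a0: "0 \<le> a (N + j)" for j using a[of "N + j"] by simp
    then have "\<not> (\<forall>m. (\<Sum>j<m. a (N + j)) \<le> C)"
      using summableI_nonneg_bounded[of "\<lambda>j. a (N + j)" C] \<open>\<not> summable (\<lambda>j. a (N + j))\<close> by blast
    then obtain m where m: "C < (\<Sum>j<m. a (N + j))" by (auto simp: not_le)
    have "C \<le> (\<Sum>j<n. a (N + j))" if "m \<le> n" for n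
    proof -
      have "(\<Sum>j<m. a (N + j)) \<le> (\<Sum>j<n. a (N + j))"
        using that a0 by (intro sum_mono2) auto
      with m show ?thesis by linarith
    qed
    then show "eventually (\<lambda>n. C \<le> (\<Sum>j<n. a (N + j))) sequentially"
      by (rule eventually_sequentiallyI)
  qed
  then have "(\<lambda>n. c * exp (- (\<Sum>j<n. a (N + j)))) \<longlonglongrightarrow> c * 0"
    by (intro tendsto_mult tendsto_const filterlim_compose[OF exp_at_bot]) (simp add: filterlim_uminus_at_bot)
  then have "eventually (\<lambda>n. c * exp (- (\<Sum>j<n. a (N + j))) < \<epsilon>) sequentially"
    using \<epsilon> by (auto dest!: order_tendstoD(2))
  then have "eventually (\<lambda>n. y (n + N) \<le> \<beta>0 + \<epsilon>) sequentially"
  proof eventually_elim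
    case (elim n)
    with le[of n] show ?case by (simp add: add.commute)
  qed
  then show ?thesis by (rule eventually_sequentially_seg[THEN iffD1])
qed

text \<open>The rescaled sequence \<open>y k = (k+1) powr \<theta> * u k\<close> satisfies an
  averaging recurrence with weights \<open>a k\<close> and targets \<open>\<beta> k\<close> tending
  to \<open>b / c\<close>. Since \<open>\<theta> < 1\<close>, the relative growth of the scaling, of
  order \<open>1/k\<close>, is negligible against \<open>c * s k\<close>, and the weights have a
  divergent sum.\<close>

lemma Chung_recurrence:
  fixes u :: "nat \<Rightarrow> real"
  assumes \<theta>: "0 < \<theta>" "\<theta> < 1" and c: "0 < c" and b: "0 \<le> b"
    and rec: "\<And>k. u (Suc k) \<le> (1 - c * (real k + 1) powr - \<theta>) * u k + b * (real k + 1) powr (- 2 * \<theta>)"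
  shows "\<exists>r \<in> o(\<lambda>k. (real k + 1) powr - \<theta>). \<forall>k. u k \<le> b / c * (real k + 1) powr - \<theta> + r k"
proof -
  define s where "s k = (real k + 1) powr - \<theta>" for k
  have s: "0 < s k" for k by (simp add: s_def)
  \<comment> \<open>\<open>q k\<close> is the ratio of consecutive scaling factors. Then
    \<open>a\<close> and \<open>\<beta>\<close> are forced by writing the recurrence for
    \<open>y\<close> in the form \<open>(1 - a k) * y k + a k * \<beta> k\<close>.\<close>
  define q where "q k = (real k + 2) powr \<theta> * s k" for k
  define a where "a k = 1 - q k * (1 - c * s k)" for k
  define \<beta> where "\<beta> k = q k * b * s k / a k" for k
  have lim: "(\<lambda>k. a k / s k) \<longlonglongrightarrow> c" "a \<longlonglongrightarrow> 0"
    unfolding a_def q_def s_def using \<theta> c by real_asymp+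
  have "\<beta> \<longlonglongrightarrow> b * inverse c"
    unfolding \<beta>_def a_def q_def s_def using \<theta> c by real_asymp
  then have lim_\<beta>: "\<beta> \<longlonglongrightarrow> b / c" by (simp add: divide_inverse)
  define y where "y k = (real k + 1) powr \<theta> * u k" for k
  have u_eq: "u k = s k * y k" for k
    by (simp add: y_def s_def powr_minus)
  \<comment> \<open>This one bound yields both the divergence of the weights and, from some index
    on, their positivity, which permits the division in \<open>\<beta>\<close>.\<close>
  have a_ge: "eventually (\<lambda>k. c / 2 * s k \<le> a k) sequentially"
    using order_tendstoD(1)[OF lim(1), of "c / 2", simplified, OF c]
    by (rule eventually_mono) (simp add: field_simps s)
  have "\<not> summable a"
  proof
    assume "summable a"
    then have "summable (\<lambda>k. c / 2 * s k)"
      using a_ge s c by (elim summable_comparison_test_ev[rotated]) (auto elim!: eventually_mono simp: less_imp_le abs_mult)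
    then have "summable s" using c by simp
    then have "summable (\<lambda>k. real (Suc k) powr - \<theta>)" by (simp add: s_def[abs_def] add.commute)
    then show False
      unfolding summable_Suc_iff[of "\<lambda>k. real k powr - \<theta>"] summable_real_powr_iff using \<theta> by simp
  qed
  have y_le: "eventually (\<lambda>k. y k \<le> b / c + \<epsilon>) sequentially" if "0 < \<epsilon>" for \<epsilon>
  proof -
    have "eventually (\<lambda>k. a k < 1) sequentially" "eventually (\<lambda>k. \<beta> k < b / c + \<epsilon> / 2) sequentially"
      using order_tendstoD(2)[OF lim(2), of 1] order_tendstoD(2)[OF lim_\<beta>, of "b / c + \<epsilon> / 2"] that
      by simp_all
    with a_ge have "eventually (\<lambda>k. c / 2 * s k \<le> a k \<and> a k \<le> 1 \<and> \<beta> k \<le> b / c + \<epsilon> / 2) sequentially"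
      by eventually_elim auto
    then obtain N where N: "\<And>k. N \<le> k \<Longrightarrow> c / 2 * s k \<le> a k \<and> a k \<le> 1 \<and> \<beta> k \<le> b / c + \<epsilon> / 2"
      unfolding eventually_sequentially by auto
    have a_pos: "0 < a k" if "N \<le> k" for k
    proof -
      have "0 < c / 2 * s k" using s c by simp
      then show ?thesis using N[OF that] by linarith
    qed
    have "y (Suc k) \<le> (1 - a k) * y k + a k * \<beta> k" if "N \<le> k" for k
    proof -
      have s2: "s k * s k = (real k + 1) powr (- 2 * \<theta>)"
        by (simp add: s_def powr_add[symmetric])
      have "y (Suc k) = (real k + 2) powr \<theta> * u (Suc k)"
        by (simp add: y_def add.commute)
      also have "\<dots> \<le> (real k + 2) powr \<theta> * ((1 - c * s k) * u k + b * (s k * s k))"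
        using rec[of k] unfolding s2 by (intro mult_left_mono) (simp_all add: s_def)
      also have "\<dots> = (1 - a k) * y k + q k * b * s k"
        unfolding u_eq[of k] by (simp add: a_def q_def algebra_simps)
      also have "q k * b * s k = a k * \<beta> k"
        using a_pos[OF that] by (simp add: \<beta>_def)
      finally show ?thesis .
    qed
    then have "eventually (\<lambda>k. y k \<le> b / c + \<epsilon> / 2 + \<epsilon> / 2) sequentially"
      using N a_pos \<open>\<not> summable a\<close> \<open>0 < \<epsilon>\<close>
      by (intro scaled_recurrence_eventually_le[of N y a \<beta>]) (auto intro: less_imp_le)
    then show ?thesis by (rule eventually_mono) linarith
  qed
  show ?thesis
  proof (intro bexI allI)
    \<comment> \<open>Taking the positive part of the excess as remainder makes the inequality hold
      for every \<open>k\<close>, while the eventual bound on \<open>y\<close> shows that it is of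
      smaller order.\<close>
    show "u k \<le> b / c * (real k + 1) powr - \<theta> + max 0 (u k - b / c * s k)" for k
      by (simp add: s_def)
    show "(\<lambda>k. max 0 (u k - b / c * s k)) \<in> o(\<lambda>k. (real k + 1) powr - \<theta>)"
    proof (rule landau_o.smallI)
      fix \<epsilon> :: real assume "0 < \<epsilon>"
      from y_le[OF this] show "eventually (\<lambda>k. norm (max 0 (u k - b / c * s k))
          \<le> \<epsilon> * norm ((real k + 1) powr - \<theta>)) sequentially"
      proof eventually_elim
        case (elim k)
        then have "s k * y k \<le> s k * (b / c + \<epsilon>)" using s[of k] by (intro mult_left_mono) auto
        then have "u k - b / c * s k \<le> \<epsilon> * s k" by (simp add: u_eq algebra_simps)
        then show ?case using s[of k] \<open>0 < \<epsilon>\<close> by (simp add: s_def)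
      qed
    qed
  qed
qed

section \<open>Sample functions and their expectation\<close>

text \<open>The pathwise hypotheses are kept apart from integrability because they are instantiated
  twice: at \<open>S\<close>, to obtain measurability of the gradient, and at the law of
  \<open>Z\<close>.\<close>

locale smooth_family =
  fixes N :: "'z measure"
    and F :: "'a::euclidean_space \<Rightarrow> 'z \<Rightarrow> real" and L :: real
  assumes F_measurable [measurable]: "\<And>y. F y \<in> borel_measurable N"
    and F_differentiable: "\<And>z y. z \<in> space N \<Longrightarrow> (\<lambda>y. F y z) differentiable (at y)"
    and F_Lipschitz: "\<And>z. z \<in> space N \<Longrightarrow> L-lipschitz_on UNIV (gradient (\<lambda>y. F y z))"
begin

definition grad :: "'a \<Rightarrow> 'z \<Rightarrow> 'a" where
  "grad y z = gradient (\<lambda>y. F y z) y"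

lemma F_quadratic_bound:
  assumes "z \<in> space N"
  shows "\<bar>F (y + v) z - F y z - grad y z \<bullet> v\<bar> \<le> L / 2 * (norm v)\<^sup>2"
  unfolding grad_def using assms
  by (intro Lipschitz_gradient_abs_bound differentiable_imp_GDERIV F_differentiable F_Lipschitz)

lemma F_continuous:
  assumes "z \<in> space N"
  shows "continuous_on UNIV (\<lambda>y. F y z)"
  using F_differentiable[OF assms] by (auto simp: continuous_on_eq_continuous_at intro: differentiable_imp_continuous_within)

lemma F_measurable_pair [measurable]: "(\<lambda>(y, z). F y z) \<in> borel_measurable (borel \<Otimes>\<^sub>M N)"
  by (intro measurable_Caratheodory F_measurable F_continuous)

text \<open>Each coordinate is a limit of difference quotients with step \<open>1 / (n+1)\<close>;
  the quadratic bound makes their error at most \<open>L / (2 * (n+1))\<close>.\<close>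

lemma grad_measurable [measurable]: "grad y \<in> borel_measurable N"
  unfolding borel_measurable_euclidean_space[of "grad y"]
proof
  fix b :: 'a assume "b \<in> Basis"
  show "(\<lambda>z. grad y z \<bullet> b) \<in> borel_measurable N"
  proof (rule borel_measurable_LIMSEQ_real)
    fix z assume z: "z \<in> space N"
    have "\<bar>real (Suc n) * (F (y + (1 / real (Suc n)) *\<^sub>R b) z - F y z) - grad y z \<bullet> b\<bar>
        \<le> L / 2 * inverse (real (Suc n))" for n
    proof -
      define t where "t = real (Suc n)"
      have t: "t > 0" by (simp add: t_def)
      have "t * (F (y + (1 / t) *\<^sub>R b) z - F y z) - grad y z \<bullet> b
          = t * (F (y + (1 / t) *\<^sub>R b) z - F y z - grad y z \<bullet> ((1 / t) *\<^sub>R b))"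
        using t by (simp add: field_simps)
      then have "\<bar>t * (F (y + (1 / t) *\<^sub>R b) z - F y z) - grad y z \<bullet> b\<bar>
          = t * \<bar>F (y + (1 / t) *\<^sub>R b) z - F y z - grad y z \<bullet> ((1 / t) *\<^sub>R b)\<bar>"
        using t by (simp add: abs_mult)
      also have "\<dots> \<le> t * (L / 2 * (norm ((1 / t) *\<^sub>R b))\<^sup>2)"
        using t by (intro mult_left_mono F_quadratic_bound z) auto
      also have "\<dots> = L / 2 * inverse t"
        using t \<open>b \<in> Basis\<close> by (simp add: field_simps power2_eq_square)
      finally show ?thesis unfolding t_def .
    qed
    then have "(\<lambda>n. real (Suc n) * (F (y + (1 / real (Suc n)) *\<^sub>R b) z - F y z) - grad y z \<bullet> b) \<longlonglongrightarrow> 0"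
      by (intro Lim_null_comparison[OF _ tendsto_mult_right_zero[OF LIMSEQ_inverse_real_of_nat, of "L / 2"]]
          always_eventually allI) (simp only: real_norm_def)
    then show "(\<lambda>n. real (Suc n) * (F (y + (1 / real (Suc n)) *\<^sub>R b) z - F y z)) \<longlonglongrightarrow> grad y z \<bullet> b"
      by (simp add: LIM_zero_iff)
  qed measurable
qed

end

locale smooth_stochastic = smooth_family N F L + prob_space N
  for N :: "'z measure" and F :: "'a::euclidean_space \<Rightarrow> 'z \<Rightarrow> real" and L :: real +
  assumes F_integrable: "\<And>y. integrable N (F y)"
    and grad_sq_integrable: "\<And>y. integrable N (\<lambda>z. (norm (grad y z))\<^sup>2)"
begin

text \<open>With the law of \<open>Z\<close> as \<open>N\<close> this is the objective
  \<open>f\<close>.\<close>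

definition mean :: "'a \<Rightarrow> real" where
  "mean y = expectation (F y)"

lemma grad_integrable: "integrable N (grad y)"
proof (rule Bochner_Integration.integrable_bound)
  show "integrable N (\<lambda>z. 1 + (norm (grad y z))\<^sup>2)"
    using grad_sq_integrable by simp
  have "r \<le> 1 + r\<^sup>2" for r :: real
    using zero_le_power2[of "r - 1"] by (simp add: power2_diff) (smt (verit) zero_le_power2)
  then show "AE z in N. norm (grad y z) \<le> norm (1 + (norm (grad y z))\<^sup>2)" by simp
qed simp

text \<open>Integrating the pathwise bound gives the descent lemma for the objective. It also shows
  that the objective has gradient \<open>expectation (grad y)\<close>, which replaces a dominated
  convergence argument.\<close>

lemma mean_quadratic_bound:
  "\<bar>mean (y + v) - mean y - expectation (grad y) \<bullet> v\<bar> \<le> L / 2 * (norm v)\<^sup>2"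
proof -
  have "mean (y + v) - mean y - expectation (grad y) \<bullet> v
      = expectation (\<lambda>z. F (y + v) z - F y z - grad y z \<bullet> v)"
    using F_integrable grad_integrable by (simp add: mean_def)
  also have "\<bar>\<dots>\<bar> \<le> expectation (\<lambda>z. L / 2 * (norm v)\<^sup>2)"
    using F_integrable grad_integrable F_quadratic_bound
    by (intro order_trans[OF integral_abs_bound integral_mono]) auto
  finally show ?thesis by (simp add: prob_space)
qed

lemma mean_GDERIV: "GDERIV mean y :> expectation (grad y)"
  unfolding gderiv_def
proof (rule has_derivativeI_sandwich[of 1])
  show "((\<lambda>w. L / 2 * norm (w - y)) \<longlongrightarrow> 0) (at y)"
    by (auto intro!: tendsto_eq_intros)
  fix w assume "w \<noteq> y"
  then show "norm (mean w - mean y - (w - y) \<bullet> expectation (grad y)) / norm (w - y)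
      \<le> L / 2 * norm (w - y)"
    using mean_quadratic_bound[of y "w - y"]
    by (simp add: field_simps power2_eq_square inner_commute)
qed (auto intro: bounded_linear_inner_left)

lemma gradient_mean: "gradient mean y = expectation (grad y)"
  by (rule gradient_eqI[OF mean_GDERIV])

lemma mean_continuous: "continuous_on UNIV mean"
  using mean_GDERIV unfolding gderiv_def
  by (auto simp: continuous_on_eq_continuous_at intro: has_derivative_continuous)

lemma mean_measurable [measurable]: "mean \<in> borel_measurable borel"
  by (rule borel_measurable_continuous_onI[OF mean_continuous])

end

section \<open>The iteration and its measurability\<close>

text \<open>Written as a function of a deterministic point and deterministic draws, so that the
  point can be frozen while the draws are averaged.\<close>

definition szd_step ::
  "(real ^ 'd \<Rightarrow> 'z \<Rightarrow> real) \<Rightarrow> real \<Rightarrow> real \<Rightarrow> real ^ 'd \<Rightarrow> 'z \<Rightarrow> real ^ 'l ^ 'd \<Rightarrow> real ^ 'd" where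
  "szd_step F a h y z p = y - a *\<^sub>R (\<Sum>i\<in>UNIV.
    ((F (y + h *\<^sub>R column i p) z - F y z) / h) *\<^sub>R column i p)"

lemma s_szd_Suc: "s_szd F \<alpha> h P Zs x0 (Suc k) \<omega> =
    szd_step F (\<alpha> k) (h k) (s_szd F \<alpha> h P Zs x0 k \<omega>) (Zs k \<omega>) (P k \<omega>)"
  by (simp add: szd_step_def Let_def)

lemma szd_step_measurable:
  fixes F :: "real ^ 'd::finite \<Rightarrow> 'z \<Rightarrow> real"
  assumes "smooth_family N F L"
  shows "(\<lambda>(y, z, p). szd_step F a h y z (p :: real ^ 'l::finite ^ 'd))
    \<in> borel_measurable (borel \<Otimes>\<^sub>M (N \<Otimes>\<^sub>M borel))"
proof -
  interpret smooth_family N F L by fact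
  have [measurable]: "(\<lambda>p::real ^ 'l ^ 'd. column i p) \<in> borel_measurable borel" for i
    by (intro borel_measurable_continuous_onI) (auto simp: column_def intro!: continuous_intros)
  have [measurable (raw)]: "(\<lambda>w. F (u w) (v w)) \<in> borel_measurable K"
    if "u \<in> borel_measurable K" "v \<in> measurable K N" for u v and K :: "'k measure"
    using measurable_compose[OF measurable_Pair[OF that] F_measurable_pair] by simp
  show ?thesis
    unfolding szd_step_def by measurable
qed

text \<open>The space \<open>T\<close> is arbitrary so that it can also be the \<sigma>-algebra
  generated by the draws before time \<open>k\<close>.\<close>

lemma s_szd_measurable:
  fixes F :: "real ^ 'd::finite \<Rightarrow> 'z \<Rightarrow> real"
    and P :: "nat \<Rightarrow> 'w \<Rightarrow> real ^ 'l::finite ^ 'd"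
  assumes "smooth_family N F L"
    and "\<And>j. j < k \<Longrightarrow> P j \<in> borel_measurable T" "\<And>j. j < k \<Longrightarrow> Zs j \<in> measurable T N"
  shows "s_szd F \<alpha> h P Zs x0 k \<in> borel_measurable T"
  using assms(2,3)
proof (induction k)
  case (Suc k)
  then have "(\<lambda>\<omega>. (s_szd F \<alpha> h P Zs x0 k \<omega>, Zs k \<omega>, P k \<omega>)) \<in> T \<rightarrow>\<^sub>M borel \<Otimes>\<^sub>M (N \<Otimes>\<^sub>M borel)"
    by (intro measurable_Pair) auto
  from measurable_compose[OF this szd_step_measurable[OF assms(1)]] show ?case
    by (simp add: s_szd_Suc[abs_def] del: s_szd.simps)
next
  case 0
  have "s_szd F \<alpha> h P Zs x0 0 = (\<lambda>\<omega>. x0)" by (rule ext) simp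
  then show ?case by simp
qed

section \<open>One step from a fixed point\<close>

lemma inner_columns:
  fixes p :: "real ^ 'l ^ 'd"
  shows "column i p \<bullet> column j p = (transpose p ** p) $ i $ j"
  by (simp add: inner_vec_def column_def matrix_matrix_mult_def transpose_def)

text \<open>This rewrites the column sums as bilinear forms in \<open>p ** transpose p\<close>, the
  matrix whose expectation is prescribed.\<close>

lemma sum_inner_columns:
  fixes p :: "real ^ 'l ^ 'd"
  shows "(\<Sum>i\<in>UNIV. (u \<bullet> column i p) * (v \<bullet> column i p)) = u \<bullet> ((p ** transpose p) *v v)"
proof -
  have "u \<bullet> ((p ** transpose p) *v v) = (u v* p) \<bullet> (transpose p *v v)"
    by (simp add: matrix_vector_mul_assoc[symmetric] dot_lmul_matrix)
  also have "\<dots> = (\<Sum>i\<in>UNIV. (u \<bullet> column i p) * (v \<bullet> column i p))"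
    by (simp add: inner_vec_def column_def matrix_vector_mult_def vector_matrix_mult_def
        transpose_def mult.commute)
  finally show ?thesis ..
qed

text \<open>Pythagoras: by the hypothesis the columns are orthogonal with squared length
  \<open>D\<close>.\<close>

lemma norm_sum_columns:
  fixes p :: "real ^ 'l ^ 'd"
  assumes "transpose p ** p = D *\<^sub>R mat 1"
  shows "(norm (\<Sum>i\<in>UNIV. c i *\<^sub>R column i p))\<^sup>2 = D * (\<Sum>i\<in>UNIV. (c i)\<^sup>2)"
proof -
  have "(norm (\<Sum>i\<in>UNIV. c i *\<^sub>R column i p))\<^sup>2
      = (\<Sum>i\<in>UNIV. \<Sum>j\<in>UNIV. c i * c j * (column i p \<bullet> column j p))"
    by (simp add: power2_norm_eq_inner inner_sum_left inner_sum_right sum_distrib_left mult.assoc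
        inner_commute[of "column _ p" "column _ p"])
  also have "\<dots> = (\<Sum>i\<in>UNIV. \<Sum>j\<in>UNIV. if i = j then D * (c i)\<^sup>2 else 0)"
    by (intro sum.cong refl) (simp add: inner_columns assms mat_def power2_eq_square)
  finally show ?thesis
    by (simp add: sum_distrib_left)
qed

locale szd_one_step = smooth_stochastic N F L + Q: prob_space Q
  for N :: "'z measure" and F :: "real ^ 'd::finite \<Rightarrow> 'z \<Rightarrow> real" and L :: real
    and Q :: "(real ^ 'l::finite ^ 'd) measure" +
  fixes a h D fmin :: real
  assumes Q_mean: "Q.expectation (\<lambda>p. p ** transpose p) = mat 1"
    and Q_orth: "AE p in Q. transpose p ** p = D *\<^sub>R mat 1"
    and a: "0 \<le> a" and h: "0 < h" and fmin: "\<And>y. fmin \<le> mean y"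
begin

lemma Q_integral_columns:
  "integrable Q (\<lambda>p. \<Sum>i\<in>UNIV. (u \<bullet> column i p) * (v \<bullet> column i p))"
  "Q.expectation (\<lambda>p. \<Sum>i\<in>UNIV. (u \<bullet> column i p) * (v \<bullet> column i p)) = u \<bullet> v"
proof -
  have lin: "bounded_linear (\<lambda>A::real ^ 'd ^ 'd. u \<bullet> (A *v v))"
  proof (rule linear_conv_bounded_linear[THEN iffD1], rule linearI)
    show "u \<bullet> ((A + B) *v v) = u \<bullet> (A *v v) + u \<bullet> (B *v v)" for A B :: "real ^ 'd ^ 'd"
      by (simp add: matrix_vector_mult_add_rdistrib inner_add_right)
    show "u \<bullet> ((r *\<^sub>R A) *v v) = r *\<^sub>R (u \<bullet> (A *v v))" for r and A :: "real ^ 'd ^ 'd"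
      by (simp add: scaleR_matrix_vector_assoc[symmetric])
  qed
  \<comment> \<open>A non-integrable function has Bochner integral \<open>0\<close>. As the
    expectation is the nonzero identity matrix, integrability follows.\<close>
  have "(mat 1 :: real ^ 'd ^ 'd) \<noteq> 0"
    by (auto simp: mat_def vec_eq_iff)
  then have int: "integrable Q (\<lambda>p. p ** transpose p)"
    using Q_mean not_integrable_integral_eq by metis
  show "integrable Q (\<lambda>p. \<Sum>i\<in>UNIV. (u \<bullet> column i p) * (v \<bullet> column i p))"
    unfolding sum_inner_columns by (rule integrable_bounded_linear[OF lin int])
  show "Q.expectation (\<lambda>p. \<Sum>i\<in>UNIV. (u \<bullet> column i p) * (v \<bullet> column i p)) = u \<bullet> v"
    unfolding sum_inner_columns integral_bounded_linear[OF lin int] Q_mean by simp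
qed

text \<open>The descent lemma is applied for fixed draws. The true gradient \<open>m\<close> and the
  sample gradient \<open>w\<close> stay inside column sums, which are left exact because their
  expectations over \<open>p\<close> are known; only the discretisation error is estimated.\<close>

lemma mean_szd_step_le:
  fixes y :: "real ^ 'd" and z :: 'z and p :: "real ^ 'l ^ 'd"
  assumes z: "z \<in> space N" and p: "transpose p ** p = D *\<^sub>R mat 1" and L: "0 \<le> L"
  defines "m \<equiv> gradient mean y" and "w \<equiv> grad y z" and "l \<equiv> real CARD('l)"
  shows "mean (szd_step F a h y z p) \<le> mean y
    + a * ((\<Sum>i\<in>UNIV. (m \<bullet> column i p) * (m \<bullet> column i p)) / 2
           - (\<Sum>i\<in>UNIV. (m \<bullet> column i p) * (w \<bullet> column i p)))
    + L * a\<^sup>2 * D * (\<Sum>i\<in>UNIV. (w \<bullet> column i p) * (w \<bullet> column i p))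
    + a * l * (L * h * D)\<^sup>2 / 8 + L * a\<^sup>2 * D * l * (L * h * D)\<^sup>2 / 4"
proof -
  define c where "c i = (F (y + h *\<^sub>R column i p) z - F y z) / h" for i
  define e where "e i = c i - w \<bullet> column i p" for i
  have colD: "(norm (column i p))\<^sup>2 = D" for i
    by (simp add: power2_norm_eq_inner inner_columns p mat_def)
  have D: "0 \<le> D" using colD[of undefined] by (metis zero_le_power2)
  have e: "(e i)\<^sup>2 \<le> (L * h * D)\<^sup>2 / 4" for i
  proof -
    \<comment> \<open>The finite difference is the directional derivative of the sample function up
      to its quadratic error along \<open>h *\<^sub>R column i p\<close>, a vector of squared length
      \<open>h\<^sup>2 * D\<close>.\<close>
    have "h * \<bar>e i\<bar> = \<bar>F (y + h *\<^sub>R column i p) z - F y z - grad y z \<bullet> (h *\<^sub>R column i p)\<bar>"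
      using h by (simp add: e_def c_def w_def field_simps flip: abs_mult_pos')
    also have "\<dots> \<le> L / 2 * (norm (h *\<^sub>R column i p))\<^sup>2"
      by (rule F_quadratic_bound[OF z])
    also have "\<dots> = h * (L * h * D / 2)"
      using colD[of i] by (simp add: power_mult_distrib) (simp add: power2_eq_square)
    finally have "\<bar>e i\<bar> \<le> L * h * D / 2"
      using h by simp
    then have "\<bar>e i\<bar>\<^sup>2 \<le> (L * h * D / 2)\<^sup>2" by (intro power_mono) auto
    then show ?thesis by (simp add: power_divide)
  qed
  have "(\<Sum>i\<in>UNIV. (e i)\<^sup>2) \<le> (\<Sum>i\<in>(UNIV::'l set). (L * h * D)\<^sup>2 / 4)"
    by (intro sum_mono e)
  then have sum_e: "(\<Sum>i\<in>UNIV. (e i)\<^sup>2) \<le> l * (L * h * D)\<^sup>2 / 4"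
    by (simp add: l_def)
  define v where "v = - a *\<^sub>R (\<Sum>i\<in>UNIV. c i *\<^sub>R column i p)"
  have step: "szd_step F a h y z p = y + v"
    by (simp add: szd_step_def v_def c_def)
  \<comment> \<open>Young's inequality for the discretisation error \<open>e\<close>\<close>
  have "- (m \<bullet> (\<Sum>i\<in>UNIV. c i *\<^sub>R column i p))
      = (\<Sum>i\<in>UNIV. - ((m \<bullet> column i p) * (w \<bullet> column i p)) - (m \<bullet> column i p) * e i)"
    by (simp add: inner_sum_right e_def algebra_simps sum_negf)
  also have "\<dots> \<le> (\<Sum>i\<in>UNIV. - ((m \<bullet> column i p) * (w \<bullet> column i p))
      + (m \<bullet> column i p) * (m \<bullet> column i p) / 2 + (e i)\<^sup>2 / 2)"
  proof (rule sum_mono)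
    fix i
    have "0 \<le> (m \<bullet> column i p + e i)\<^sup>2" by simp
    then show "- ((m \<bullet> column i p) * (w \<bullet> column i p)) - (m \<bullet> column i p) * e i
      \<le> - ((m \<bullet> column i p) * (w \<bullet> column i p)) + (m \<bullet> column i p) * (m \<bullet> column i p) / 2 + (e i)\<^sup>2 / 2"
      unfolding power2_sum unfolding power2_eq_square by linarith
  qed
  also have "\<dots> \<le> (\<Sum>i\<in>UNIV. (m \<bullet> column i p) * (m \<bullet> column i p)) / 2
      - (\<Sum>i\<in>UNIV. (m \<bullet> column i p) * (w \<bullet> column i p)) + l * (L * h * D)\<^sup>2 / 8"
    using sum_e by (simp add: sum.distrib sum_subtractf sum_divide_distrib[symmetric])
  finally have "a * - (m \<bullet> (\<Sum>i\<in>UNIV. c i *\<^sub>R column i p)) \<le> a * ((\<Sum>i\<in>UNIV. (m \<bullet> column i p) * (m \<bullet> column i p)) / 2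
      - (\<Sum>i\<in>UNIV. (m \<bullet> column i p) * (w \<bullet> column i p)) + l * (L * h * D)\<^sup>2 / 8)"
    by (rule mult_left_mono[OF _ a])
  then have linear: "m \<bullet> v \<le> a * ((\<Sum>i\<in>UNIV. (m \<bullet> column i p) * (m \<bullet> column i p)) / 2
      - (\<Sum>i\<in>UNIV. (m \<bullet> column i p) * (w \<bullet> column i p))) + a * l * (L * h * D)\<^sup>2 / 8"
    by (simp add: v_def algebra_simps)
  \<comment> \<open>Splitting \<open>c\<close> into exact part and error costs a factor
    \<open>2\<close>, which turns the \<open>L / 2\<close> of the descent lemma into
    \<open>L\<close>.\<close>
  have "(\<Sum>i\<in>UNIV. (c i)\<^sup>2) \<le> (\<Sum>i\<in>UNIV. 2 * ((w \<bullet> column i p) * (w \<bullet> column i p)) + 2 * (e i)\<^sup>2)"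
  proof (rule sum_mono)
    fix i
    have "0 \<le> (w \<bullet> column i p - e i)\<^sup>2" by simp
    moreover have "c i = w \<bullet> column i p + e i" by (simp add: e_def)
    ultimately show "(c i)\<^sup>2 \<le> 2 * ((w \<bullet> column i p) * (w \<bullet> column i p)) + 2 * (e i)\<^sup>2"
      unfolding power2_diff by (simp add: power2_sum) (simp add: power2_eq_square)
  qed
  also have "\<dots> \<le> 2 * (\<Sum>i\<in>UNIV. (w \<bullet> column i p) * (w \<bullet> column i p)) + l * (L * h * D)\<^sup>2 / 2"
    using sum_e by (simp add: sum.distrib sum_distrib_left[symmetric])
  finally have "L / 2 * (a\<^sup>2 * (D * (\<Sum>i\<in>UNIV. (c i)\<^sup>2))) \<le> L / 2 * (a\<^sup>2 * (D *
      (2 * (\<Sum>i\<in>UNIV. (w \<bullet> column i p) * (w \<bullet> column i p)) + l * (L * h * D)\<^sup>2 / 2)))"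
    using L D by (intro mult_left_mono) auto
  moreover have "(norm v)\<^sup>2 = a\<^sup>2 * (D * (\<Sum>i\<in>UNIV. (c i)\<^sup>2))"
    by (simp add: v_def power_mult_distrib norm_sum_columns[OF p])
  ultimately have quad: "L / 2 * (norm v)\<^sup>2 \<le> L * a\<^sup>2 * D * (\<Sum>i\<in>UNIV. (w \<bullet> column i p) * (w \<bullet> column i p))
      + L * a\<^sup>2 * D * l * (L * h * D)\<^sup>2 / 4"
    by (simp add: algebra_simps)
  show ?thesis
    using mean_quadratic_bound[of y v] linear quad unfolding step m_def gradient_mean by linarith
qed

text \<open>Averaging over \<open>p\<close> turns column sums into inner products; averaging over
  \<open>z\<close> then replaces the sample gradient by \<open>m\<close>. The linear term
  \<open>- a * (norm m)\<^sup>2\<close> loses half to Young's inequality. Nonnegative integrals are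
  used since integrability after the step is not yet known.\<close>

lemma expected_step_le:
  assumes L: "0 \<le> L"
  defines "l \<equiv> real CARD('l)"
  defines "R \<equiv> \<lambda>y. mean y - fmin - a / 2 * (norm (gradient mean y))\<^sup>2
    + L * a\<^sup>2 * D * expectation (\<lambda>z. (norm (grad y z))\<^sup>2)
    + a * l * (L * h * D)\<^sup>2 / 8 + L * a\<^sup>2 * D * l * (L * h * D)\<^sup>2 / 4"
  shows "0 \<le> R y"
    and "(\<integral>\<^sup>+z. \<integral>\<^sup>+p. ennreal (mean (szd_step F a h y z p) - fmin) \<partial>Q \<partial>N) \<le> ennreal (R y)"
proof -
  define m where "m = gradient mean y"
  define C where "C = a * l * (L * h * D)\<^sup>2 / 8 + L * a\<^sup>2 * D * l * (L * h * D)\<^sup>2 / 4"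
  define \<Phi> where "\<Phi> z p = mean y - fmin
    + a * ((\<Sum>i\<in>UNIV. (m \<bullet> column i p) * (m \<bullet> column i p)) / 2
           - (\<Sum>i\<in>UNIV. (m \<bullet> column i p) * (grad y z \<bullet> column i p)))
    + L * a\<^sup>2 * D * (\<Sum>i\<in>UNIV. (grad y z \<bullet> column i p) * (grad y z \<bullet> column i p)) + C"
    for z and p :: "real ^ 'l ^ 'd"
  define r where "r z = mean y - fmin + a * ((norm m)\<^sup>2 / 2 - m \<bullet> grad y z)
    + L * a\<^sup>2 * D * (norm (grad y z))\<^sup>2 + C" for z
  have le: "AE p in Q. mean (szd_step F a h y z p) - fmin \<le> \<Phi> z p" if "z \<in> space N" for z
    using Q_orth
  proof eventually_elim
    case (elim p)
    from mean_szd_step_le[OF that elim L, of y] show ?case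
      by (simp add: \<Phi>_def m_def C_def l_def)
  qed
  have \<Phi>_int: "integrable Q (\<Phi> z)" and \<Phi>_eq: "Q.expectation (\<Phi> z) = r z" for z
    using Q_integral_columns
    by (auto simp: \<Phi>_def[abs_def] r_def Q.prob_space power2_norm_eq_inner)
  \<comment> \<open>\<open>ennreal\<close> cuts off negative values, so each upper bound must be
    nonnegative before its integral can be evaluated; it inherits this from
    \<open>fmin \<le> mean\<close>.\<close>
  have nonneg: "AE p in Q. 0 \<le> \<Phi> z p" if "z \<in> space N" for z
    using le[OF that] by eventually_elim (smt (verit) fmin)
  have r_nonneg: "0 \<le> r z" if "z \<in> space N" for z
    unfolding \<Phi>_eq[symmetric] by (rule integral_nonneg_AE[OF nonneg[OF that]])
  have inner: "(\<integral>\<^sup>+p. ennreal (mean (szd_step F a h y z p) - fmin) \<partial>Q) \<le> ennreal (r z)"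
    if "z \<in> space N" for z
  proof -
    have "(\<integral>\<^sup>+p. ennreal (mean (szd_step F a h y z p) - fmin) \<partial>Q) \<le> (\<integral>\<^sup>+p. ennreal (\<Phi> z p) \<partial>Q)"
      using le[OF that] by (intro nn_integral_mono_AE) (auto elim!: eventually_mono intro: ennreal_leI)
    also have "\<dots> = ennreal (r z)"
      using nn_integral_eq_integral[OF \<Phi>_int nonneg[OF that]] by (simp add: \<Phi>_eq)
    finally show ?thesis .
  qed
  have r_int: "integrable N r"
    using grad_integrable[of y] grad_sq_integrable[of y]
    by (auto simp: r_def[abs_def])
  have "expectation r = mean y - fmin + a * ((norm m)\<^sup>2 / 2 - m \<bullet> expectation (grad y))
    + L * a\<^sup>2 * D * expectation (\<lambda>z. (norm (grad y z))\<^sup>2) + C"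
    using grad_integrable[of y] grad_sq_integrable[of y]
    by (simp add: r_def[abs_def] prob_space)
  also have "m \<bullet> expectation (grad y) = (norm m)\<^sup>2"
    by (simp add: m_def gradient_mean power2_norm_eq_inner)
  finally have r_eq: "expectation r = R y"
    by (simp add: R_def C_def m_def algebra_simps)
  show "0 \<le> R y"
    unfolding r_eq[symmetric] by (rule integral_nonneg_AE) (use r_nonneg in auto)
  have "(\<integral>\<^sup>+z. \<integral>\<^sup>+p. ennreal (mean (szd_step F a h y z p) - fmin) \<partial>Q \<partial>N) \<le> (\<integral>\<^sup>+z. ennreal (r z) \<partial>N)"
    by (intro nn_integral_mono inner)
  also have "\<dots> = ennreal (R y)"
    using nn_integral_eq_integral[OF r_int] r_nonneg by (simp add: r_eq)
  finally show "(\<integral>\<^sup>+z. \<integral>\<^sup>+p. ennreal (mean (szd_step F a h y z p) - fmin) \<partial>Q \<partial>N) \<le> ennreal (R y)" .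
qed

end

section \<open>Independence of the past and the expected recursion\<close>

lemma (in prob_space) vimage_measurable_sigma:
  assumes "X \<in> measurable M A" and "i \<in> K" and "E i = {X -` C \<inter> space M | C. C \<in> sets A}"
    and sub: "(\<Union>i\<in>K. E i) \<subseteq> Pow (space M)"
  shows "X \<in> measurable (sigma (space M) (\<Union>i\<in>K. E i)) A"
proof (rule measurableI)
  show "X \<omega> \<in> space A" if "\<omega> \<in> space (sigma (space M) (\<Union>i\<in>K. E i))" for \<omega>
    using that assms(1) sub by (auto simp: space_measure_of measurable_def)
  fix C assume "C \<in> sets A"
  then have "X -` C \<inter> space M \<in> (\<Union>i\<in>K. E i)"
    using assms(2,3) by blast
  then show "X -` C \<inter> space (sigma (space M) (\<Union>i\<in>K. E i)) \<in> sets (sigma (space M) (\<Union>i\<in>K. E i))"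
    using sub by (simp add: space_measure_of sigma_sets.Basic)
qed

locale szd_process = M: prob_space M + smooth_stochastic "distr M S Z" F L
  for M :: "'w measure" and S :: "'z measure" and Z :: "'w \<Rightarrow> 'z"
    and F :: "real ^ 'd::finite \<Rightarrow> 'z \<Rightarrow> real" and L :: real +
  fixes Zs :: "nat \<Rightarrow> 'w \<Rightarrow> 'z" and P :: "nat \<Rightarrow> 'w \<Rightarrow> real ^ 'l::finite ^ 'd"
    and \<alpha> h :: "nat \<Rightarrow> real" and x0 :: "real ^ 'd" and D fmin :: real
  assumes D: "D = real CARD('d) / real CARD('l)" and sampling: "szd_sampling M S Z Zs P"
    and L: "0 \<le> L" and \<alpha>: "\<And>k. 0 \<le> \<alpha> k" and h: "\<And>k. 0 < h k" and fmin: "\<And>y. fmin \<le> mean y"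
begin

abbreviation "x \<equiv> s_szd F \<alpha> h P Zs x0"

lemma Zs_measurable: "Zs k \<in> measurable M S" and P_measurable: "P k \<in> borel_measurable M"
  using sampling unfolding szd_sampling_def by auto

lemma distr_Zs: "distr M (distr M S Z) (Zs k) = distr M S Z"
proof -
  have "distr M (distr M S Z) (Zs k) = distr M S (Zs k)"
    by (intro distr_cong) auto
  then show ?thesis using sampling unfolding szd_sampling_def by metis
qed

lemma x_measurable: "x k \<in> borel_measurable M"
  by (rule s_szd_measurable[OF smooth_family_axioms]) (auto simp: P_measurable Zs_measurable)

lemma one_step: "szd_one_step (distr M S Z) F L (distr M borel (P k)) (\<alpha> k) (h k) D fmin"
proof (intro szd_one_step.intro smooth_stochastic_axioms szd_one_step_axioms.intro)
  show "prob_space (distr M borel (P k))"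
    by (rule M.prob_space_distr[OF P_measurable])
  have [measurable]: "(\<lambda>p::real ^ 'l ^ 'd. p ** transpose p) \<in> borel_measurable borel"
    by (intro borel_measurable_continuous_onI)
      (auto simp: matrix_matrix_mult_def transpose_def intro!: continuous_intros)
  show "prob_space.expectation (distr M borel (P k)) (\<lambda>p. p ** transpose p) = mat 1"
    using sampling P_measurable unfolding szd_sampling_def by (subst integral_distr) auto
  \<comment> \<open>Closedness makes the event measurable, so the almost sure identity passes from
    \<open>M\<close> to the law of \<open>P k\<close>.\<close>
  have "closed {p::real ^ 'l ^ 'd. transpose p ** p = D *\<^sub>R mat 1}"
    by (intro closed_Collect_eq continuous_on_const)
      (auto simp: matrix_matrix_mult_def transpose_def intro!: continuous_intros)
  then have "{p::real ^ 'l ^ 'd. transpose p ** p = D *\<^sub>R mat 1} \<in> sets borel"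
    by (rule borel_closed)
  then show "AE p in distr M borel (P k). transpose p ** p = D *\<^sub>R mat 1"
    using sampling P_measurable unfolding szd_sampling_def D by (subst AE_distr_iff) auto
qed (use \<alpha> h fmin in auto)

text \<open>The product form is what permits conditioning on \<open>x k\<close>: by Tonelli the
  current draws are integrated with the iterate held fixed.\<close>

lemma distr_x_Zs_P:
  "distr M (borel \<Otimes>\<^sub>M (distr M S Z \<Otimes>\<^sub>M borel)) (\<lambda>\<omega>. (x k \<omega>, Zs k \<omega>, P k \<omega>)) =
    distr M borel (x k) \<Otimes>\<^sub>M (distr M S Z \<Otimes>\<^sub>M distr M borel (P k))"
proof -
  define E where "E j = (case j of
      Inl k \<Rightarrow> {P k -` C \<inter> space M | C. C \<in> sets borel}
    | Inr k \<Rightarrow> {Zs k -` C \<inter> space M | C. C \<in> sets S})" for j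
  have indep: "M.indep_sets E UNIV"
    using sampling unfolding szd_sampling_def E_def[abs_def] by blast
  have vimage_Int_stable: "Int_stable {X -` C \<inter> space M | C. C \<in> sets A}" for X :: "'w \<Rightarrow> 'b" and A
  proof (rule Int_stableI, safe)
    fix C C' assume "C \<in> sets A" "C' \<in> sets A"
    then show "\<exists>C''. X -` C \<inter> space M \<inter> (X -` C' \<inter> space M) = X -` C'' \<inter> space M \<and> C'' \<in> sets A"
      by (intro exI[of _ "C \<inter> C'"]) auto
  qed
  have Int: "Int_stable (E j)" for j
    by (simp add: E_def vimage_Int_stable split: sum.split)
  have sub: "(\<Union>j\<in>K. E j) \<subseteq> Pow (space M)" for K
    by (auto simp: E_def split: sum.splits)
  have P: "P j \<in> borel_measurable (sigma (space M) (\<Union>i\<in>K. E i))" if "Inl j \<in> K" for j K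
    by (rule M.vimage_measurable_sigma[OF P_measurable that _ sub]) (simp add: E_def)
  have "Zs j \<in> measurable (sigma (space M) (\<Union>i\<in>K. E i)) S" if "Inr j \<in> K" for j K
    by (rule M.vimage_measurable_sigma[OF Zs_measurable that _ sub]) (simp add: E_def)
  then have Zs: "Zs j \<in> measurable (sigma (space M) (\<Union>i\<in>K. E i)) (distr M S Z)" if "Inr j \<in> K" for j K
    using that by simp
  \<comment> \<open>The indices are strictly below \<open>k\<close>, because \<open>x k\<close> is
    built from the draws \<open>0\<close> to \<open>k - 1\<close> and so shares none with step
    \<open>k\<close>.\<close>
  define past where "past = Inl ` {..<k} \<union> Inr ` {..<k}"
  have "x k \<in> borel_measurable (sigma (space M) (\<Union>i\<in>past. E i))"
    by (intro s_szd_measurable[OF smooth_family_axioms] P Zs) (auto simp: past_def)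
  moreover have "(\<lambda>\<omega>. (Zs k \<omega>, P k \<omega>)) \<in>
      measurable (sigma (space M) (\<Union>i\<in>{Inl k, Inr k}. E i)) (distr M S Z \<Otimes>\<^sub>M borel)"
    by (intro measurable_Pair P Zs) auto
  moreover have "past \<inter> {Inl k, Inr k} = {}" by (auto simp: past_def)
  ultimately have "distr M (borel \<Otimes>\<^sub>M (distr M S Z \<Otimes>\<^sub>M borel)) (\<lambda>\<omega>. (x k \<omega>, Zs k \<omega>, P k \<omega>)) =
      distr M borel (x k) \<Otimes>\<^sub>M distr M (distr M S Z \<Otimes>\<^sub>M borel) (\<lambda>\<omega>. (Zs k \<omega>, P k \<omega>))"
    by (intro M.distr_Pair_indep_sigma[OF indep Int])
  also have "distr M (distr M S Z \<Otimes>\<^sub>M borel) (\<lambda>\<omega>. (Zs k \<omega>, P k \<omega>)) =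
      distr M (distr M S Z) (Zs k) \<Otimes>\<^sub>M distr M borel (P k)"
    by (intro M.distr_Pair_indep_sigma[OF indep Int, where K = "{Inr k}" and L = "{Inl k}"] P Zs) auto
  finally show ?thesis unfolding distr_Zs .
qed

text \<open>Tonelli with the one-step estimate bounds a nonnegative integral by a finite number.
  This supplies integrability at \<open>Suc k\<close> together with the recursion, so both can be
  propagated by induction.\<close>

lemma expected_iterate_step:
  assumes int: "integrable M (\<lambda>\<omega>. mean (x k \<omega>) - fmin)"
    and bound: "\<And>y. mean y - fmin - \<alpha> k / 2 * (norm (gradient mean y))\<^sup>2
      + L * (\<alpha> k)\<^sup>2 * D * expectation (\<lambda>z. (norm (grad y z))\<^sup>2)
      + \<alpha> k * real CARD('l) * (L * h k * D)\<^sup>2 / 8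
      + L * (\<alpha> k)\<^sup>2 * D * real CARD('l) * (L * h k * D)\<^sup>2 / 4 \<le> \<rho> * (mean y - fmin) + b"
  shows "integrable M (\<lambda>\<omega>. mean (x (Suc k) \<omega>) - fmin)"
    and "M.expectation (\<lambda>\<omega>. mean (x (Suc k) \<omega>) - fmin)
      \<le> \<rho> * M.expectation (\<lambda>\<omega>. mean (x k \<omega>) - fmin) + b"
proof -
  interpret O: szd_one_step "distr M S Z" F L "distr M borel (P k)" "\<alpha> k" "h k" D fmin
    by (rule one_step)
  interpret NQ: prob_space "distr M S Z \<Otimes>\<^sub>M distr M borel (P k)"
    by (intro prob_space_pair O.Q.prob_space_axioms prob_space_axioms)
  define g where "g = (\<lambda>(y, z, p :: real ^ 'l ^ 'd). ennreal (mean (szd_step F (\<alpha> k) (h k) y z p) - fmin))"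
  have "(\<lambda>w. case w of (y, z, p) \<Rightarrow> szd_step F (\<alpha> k) (h k) y z p)
      \<in> borel_measurable (borel \<Otimes>\<^sub>M (distr M S Z \<Otimes>\<^sub>M (borel :: (real ^ 'l ^ 'd) measure)))"
    by (rule szd_step_measurable[OF smooth_family_axioms])
  from measurable_compose[OF this, of "\<lambda>y. ennreal (mean y - fmin)" borel]
  have g_meas: "g \<in> borel_measurable (borel \<Otimes>\<^sub>M (distr M S Z \<Otimes>\<^sub>M borel))"
    unfolding g_def by (simp add: case_prod_beta')
  have g_meas': "g \<in> borel_measurable (distr M borel (x k) \<Otimes>\<^sub>M (distr M S Z \<Otimes>\<^sub>M distr M borel (P k)))"
    using g_meas by (simp cong: measurable_cong_sets sets_pair_measure_cong)
  have triple: "(\<lambda>\<omega>. (x k \<omega>, Zs k \<omega>, P k \<omega>)) \<in> measurable M (borel \<Otimes>\<^sub>M (distr M S Z \<Otimes>\<^sub>M borel))"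
    using x_measurable Zs_measurable P_measurable by (intro measurable_Pair) auto
  have bnd: "(\<integral>\<^sup>+z. \<integral>\<^sup>+p. g (y, z, p) \<partial>distr M borel (P k) \<partial>distr M S Z) \<le> ennreal (\<rho> * (mean y - fmin) + b)"
    and bnd_nonneg: "0 \<le> \<rho> * (mean y - fmin) + b" for y
    using O.expected_step_le[OF L, of y] bound[of y]
    by (auto simp: g_def intro: order_trans ennreal_leI)
  have "(\<integral>\<^sup>+\<omega>. ennreal (mean (x (Suc k) \<omega>) - fmin) \<partial>M) = (\<integral>\<^sup>+\<omega>. g (x k \<omega>, Zs k \<omega>, P k \<omega>) \<partial>M)"
    by (simp add: g_def s_szd_Suc del: s_szd.simps)
  also have "\<dots> = (\<integral>\<^sup>+w. g w \<partial>(distr M borel (x k) \<Otimes>\<^sub>M (distr M S Z \<Otimes>\<^sub>M distr M borel (P k))))"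
    unfolding distr_x_Zs_P[symmetric] by (subst nn_integral_distr[OF triple]) (use g_meas in auto)
  also have "\<dots> = (\<integral>\<^sup>+y. \<integral>\<^sup>+v. g (y, v) \<partial>(distr M S Z \<Otimes>\<^sub>M distr M borel (P k)) \<partial>distr M borel (x k))"
    by (rule NQ.nn_integral_fst[OF g_meas', symmetric])
  also have "\<dots> = (\<integral>\<^sup>+y. \<integral>\<^sup>+z. \<integral>\<^sup>+p. g (y, z, p) \<partial>distr M borel (P k) \<partial>distr M S Z \<partial>distr M borel (x k))"
    by (intro nn_integral_cong O.Q.nn_integral_fst[symmetric] measurable_Pair2[OF g_meas'])
  also have "\<dots> \<le> (\<integral>\<^sup>+y. ennreal (\<rho> * (mean y - fmin) + b) \<partial>distr M borel (x k))"
    by (intro nn_integral_mono bnd)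
  also have "\<dots> = (\<integral>\<^sup>+\<omega>. ennreal (\<rho> * (mean (x k \<omega>) - fmin) + b) \<partial>M)"
    by (intro nn_integral_distr x_measurable) measurable
  also have "\<dots> = ennreal (M.expectation (\<lambda>\<omega>. \<rho> * (mean (x k \<omega>) - fmin) + b))"
    using int bnd_nonneg by (intro nn_integral_eq_integral) auto
  also have "M.expectation (\<lambda>\<omega>. \<rho> * (mean (x k \<omega>) - fmin) + b)
      = \<rho> * M.expectation (\<lambda>\<omega>. mean (x k \<omega>) - fmin) + b"
    using int by (simp add: M.prob_space)
  finally have le: "(\<integral>\<^sup>+\<omega>. ennreal (mean (x (Suc k) \<omega>) - fmin) \<partial>M)
      \<le> ennreal (\<rho> * M.expectation (\<lambda>\<omega>. mean (x k \<omega>) - fmin) + b)" .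
  have meas: "(\<lambda>\<omega>. mean (x (Suc k) \<omega>) - fmin) \<in> borel_measurable M"
    by (intro borel_measurable_diff measurable_compose[OF x_measurable mean_measurable] borel_measurable_const)
  show int': "integrable M (\<lambda>\<omega>. mean (x (Suc k) \<omega>) - fmin)"
    by (rule integrableI_nonneg[OF meas]) (use fmin le in \<open>auto simp: le_less_trans simp del: s_szd.simps\<close>)
  \<comment> \<open>Needed to remove \<open>ennreal\<close> from the right-hand side of
    \<open>le\<close>.\<close>
  have nonneg: "0 \<le> \<rho> * M.expectation (\<lambda>\<omega>. mean (x k \<omega>) - fmin) + b"
  proof -
    have "0 \<le> M.expectation (\<lambda>\<omega>. \<rho> * (mean (x k \<omega>) - fmin) + b)"
      using bnd_nonneg by (intro integral_nonneg_AE) auto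
    then show ?thesis using int by (simp add: M.prob_space)
  qed
  have "ennreal (M.expectation (\<lambda>\<omega>. mean (x (Suc k) \<omega>) - fmin))
      = (\<integral>\<^sup>+\<omega>. ennreal (mean (x (Suc k) \<omega>) - fmin) \<partial>M)"
    using fmin by (intro nn_integral_eq_integral[OF int', symmetric]) auto
  with le nonneg show "M.expectation (\<lambda>\<omega>. mean (x (Suc k) \<omega>) - fmin)
      \<le> \<rho> * M.expectation (\<lambda>\<omega>. mean (x k \<omega>) - fmin) + b"
    by (metis ennreal_le_iff)
qed

end

section \<open>Constants of the recursion and the rate\<close>

text \<open>Here \<open>s\<close> stands for \<open>(k+1) powr - \<theta>\<close>,
  \<open>\<Delta>\<close> for the gap, \<open>m2\<close> for the squared gradient norm and
  \<open>EG\<close> for the second moment of the sample gradient. The outcome has the shape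
  \<open>(1 - c * s) * \<Delta> + b * s\<^sup>2\<close> required by Chung's lemma.\<close>

lemma PL_step_bound:
  fixes \<Delta> m2 EG A B G L D l d \<gamma> \<eta> \<alpha>bar hbar s a h :: real
  assumes PL: "\<gamma> * \<Delta> \<le> m2" and ABG: "EG \<le> A * \<Delta> + B * m2 + G"
    and pos: "0 \<le> \<Delta>" "0 \<le> A" "0 \<le> B" "0 < \<gamma>" "0 < L" "0 < l" "0 < d" "0 < \<alpha>bar" "0 < s" "s \<le> 1"
    and \<eta>: "0 \<le> \<eta>" "\<eta> < 1" "2 * \<alpha>bar * L * d * (A + \<gamma> * B) = \<gamma> * l * \<eta>"
    and defs: "D = d / l" "a = \<alpha>bar * s" "h\<^sup>2 = hbar\<^sup>2 * s"
  shows "\<Delta> - a / 2 * m2 + L * a\<^sup>2 * D * EG + a * l * (L * h * D)\<^sup>2 / 8 + L * a\<^sup>2 * D * l * (L * h * D)\<^sup>2 / 4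
    \<le> (1 - \<alpha>bar * \<gamma> * (1 - \<eta>) / 2 * s) * \<Delta>
      + L * d / l * (G * \<alpha>bar\<^sup>2 + hbar\<^sup>2 * L * d * \<alpha>bar / 8 + hbar\<^sup>2 * L\<^sup>2 * d\<^sup>2 * \<alpha>bar\<^sup>2 / (4 * l)) * s\<^sup>2"
proof -
  define \<kappa> where "\<kappa> = L * D * \<alpha>bar"
  have \<kappa>: "0 < \<kappa>" using pos by (simp add: \<kappa>_def defs)
  have a: "0 < a" using pos by (simp add: defs)
  have \<kappa>_eq: "2 * \<kappa> * (A + \<gamma> * B) = \<gamma> * \<eta>"
  proof -
    have "2 * \<kappa> * (A + \<gamma> * B) = (2 * \<alpha>bar * L * d * (A + \<gamma> * B)) / l"
      by (simp add: \<kappa>_def defs)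
    also have "\<dots> = \<gamma> * \<eta>" using pos unfolding \<eta>(3) by simp
    finally show ?thesis .
  qed
  have "\<gamma> * (2 * \<kappa> * B) \<le> \<gamma> * \<eta>"
    unfolding \<kappa>_eq[symmetric] using mult_nonneg_nonneg[of \<kappa> A] \<kappa> pos
    by (simp add: distrib_left del: mult_le_cancel_left_pos)
  then have "2 * \<kappa> * B \<le> 1" using pos \<eta> by simp
  then have "s * (2 * \<kappa> * B) \<le> 1 * 1" using pos \<kappa> by (intro mult_mono) auto
  \<comment> \<open>After the ABG bound, \<open>m2\<close> carries minus this coefficient. Its sign,
    a consequence of the step-size condition, allows \<open>m2\<close> to be replaced by its lower
    bound \<open>\<gamma> * \<Delta>\<close>.\<close>
  then have coef: "0 \<le> a / 2 - a * s * \<kappa> * B"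
    using a mult_left_mono[of "s * (2 * \<kappa> * B)" 1 a] by (simp add: algebra_simps)
  have La: "L * a\<^sup>2 * D = a * s * \<kappa>"
    by (simp add: \<kappa>_def defs power2_eq_square)
  have "L * a\<^sup>2 * D * EG \<le> a * s * \<kappa> * (A * \<Delta> + B * m2 + G)"
    unfolding La using ABG a pos \<kappa> by (intro mult_left_mono) auto
  then have "\<Delta> - a / 2 * m2 + L * a\<^sup>2 * D * EG
      \<le> \<Delta> - (a / 2 - a * s * \<kappa> * B) * m2 + a * s * \<kappa> * A * \<Delta> + a * s * \<kappa> * G"
    by (simp add: algebra_simps)
  also have "\<dots> \<le> \<Delta> - (a / 2 - a * s * \<kappa> * B) * (\<gamma> * \<Delta>) + a * s * \<kappa> * A * \<Delta> + a * s * \<kappa> * G"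
    using mult_left_mono[OF PL coef] by simp
  also have "\<dots> = \<Delta> - a * \<gamma> / 2 * \<Delta> + a * s / 2 * (2 * \<kappa> * (A + \<gamma> * B)) * \<Delta> + a * s * \<kappa> * G"
    by (simp add: algebra_simps)
  also have "\<dots> = \<Delta> - a * \<gamma> / 2 * \<Delta> + s * (a * \<gamma> * \<eta> / 2 * \<Delta>) + a * s * \<kappa> * G"
    unfolding \<kappa>_eq by simp
  \<comment> \<open>Dropping \<open>s \<le> 1\<close> here leaves the fraction
    \<open>1 - \<eta>\<close> of the contraction.\<close>
  also have "\<dots> \<le> \<Delta> - a * \<gamma> / 2 * \<Delta> + 1 * (a * \<gamma> * \<eta> / 2 * \<Delta>) + a * s * \<kappa> * G"
    using a pos \<eta> by (intro add_mono mult_right_mono order_refl) auto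
  also have "\<dots> = (1 - \<alpha>bar * \<gamma> * (1 - \<eta>) / 2 * s) * \<Delta> + L * d / l * (G * \<alpha>bar\<^sup>2) * s\<^sup>2"
    by (simp add: \<kappa>_def defs power2_eq_square field_simps)
  finally have 1: "\<Delta> - a / 2 * m2 + L * a\<^sup>2 * D * EG
      \<le> (1 - \<alpha>bar * \<gamma> * (1 - \<eta>) / 2 * s) * \<Delta> + L * d / l * (G * \<alpha>bar\<^sup>2) * s\<^sup>2" .
  have LhD: "(L * h * D)\<^sup>2 = L\<^sup>2 * (hbar\<^sup>2 * s) * (d / l)\<^sup>2"
    by (simp add: power_mult_distrib power_divide defs)
  have 2: "a * l * (L * h * D)\<^sup>2 / 8 = L * d / l * (hbar\<^sup>2 * L * d * \<alpha>bar / 8) * s\<^sup>2"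
    unfolding LhD using pos by (simp add: defs power2_eq_square field_simps)
  \<comment> \<open>This term is of order \<open>s ^ 3\<close>; one factor \<open>s \<le> 1\<close>
    is given up to fit it under \<open>s\<^sup>2\<close>.\<close>
  have "L * a\<^sup>2 * D * l * (L * h * D)\<^sup>2 / 4
      = s * (L * d / l * (hbar\<^sup>2 * L\<^sup>2 * d\<^sup>2 * \<alpha>bar\<^sup>2 / (4 * l)) * s\<^sup>2)"
    unfolding LhD using pos by (simp add: defs power2_eq_square field_simps)
  also have "\<dots> \<le> 1 * (L * d / l * (hbar\<^sup>2 * L\<^sup>2 * d\<^sup>2 * \<alpha>bar\<^sup>2 / (4 * l)) * s\<^sup>2)"
    using pos by (intro mult_right_mono) auto
  finally have 3: "L * a\<^sup>2 * D * l * (L * h * D)\<^sup>2 / 4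
      \<le> L * d / l * (hbar\<^sup>2 * L\<^sup>2 * d\<^sup>2 * \<alpha>bar\<^sup>2 / (4 * l)) * s\<^sup>2" by simp
  show ?thesis unfolding distrib_left distrib_right using 1 2 3 by linarith
qed

text \<open>Integrability is part of the conclusion so that the expectations are genuine and not the
  default value \<open>0\<close>.\<close>

theorem corollary3:
  fixes M :: "'w measure" and S :: "'z measure"
    and Z :: "'w \<Rightarrow> 'z" and Zs :: "nat \<Rightarrow> 'w \<Rightarrow> 'z"
    and P :: "nat \<Rightarrow> 'w \<Rightarrow> real ^ 'l::finite ^ 'd::finite"
    and F :: "real ^ 'd \<Rightarrow> 'z \<Rightarrow> real" and f :: "real ^ 'd \<Rightarrow> real"
    and fstar lam A B G \<gamma> \<alpha>bar hbar \<theta> \<eta> d l :: real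
    and \<alpha> h :: "nat \<Rightarrow> real"
    and x0 :: "real ^ 'd" and x :: "nat \<Rightarrow> 'w \<Rightarrow> real ^ 'd"
  defines "d \<equiv> real CARD('d)" and "l \<equiv> real CARD('l)"
    and "f \<equiv> objective M Z F" and "fstar \<equiv> (INF y. f y)"
    and "\<alpha> \<equiv> (\<lambda>k. \<alpha>bar * (real k + 1) powr (- \<theta>))"
    and "h \<equiv> (\<lambda>k. hbar * (real k + 1) powr (- \<theta> / 2))"
    and "x \<equiv> s_szd F \<alpha> h P Zs x0"
  assumes "prob_space M"
    and "CARD('l) \<le> CARD('d)"
    and "Z \<in> measurable M S"
    and "\<And>y. F y \<in> borel_measurable S"
    and "smoothness_ABG M S Z F lam A B G"
    and "polyak_lojasiewicz f \<gamma>"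
    and "szd_sampling M S Z Zs P"
    and "\<alpha>bar > 0" and "hbar > 0" and "1 / 2 < \<theta>" and "\<theta> < 1"
    and "A + \<gamma> * B > 0 \<Longrightarrow>
      0 \<le> \<eta> \<and> \<eta> < 1 \<and> 2 * \<alpha>bar * lam * d * (A + \<gamma> * B) = \<gamma> * l * \<eta>"
    and "A = 0 \<Longrightarrow> B = 0 \<Longrightarrow> \<eta> = 0"
  shows "(\<forall>k. integrable M (\<lambda>\<omega>. f (x k \<omega>) - fstar)) \<and>
    (\<exists>r \<in> o(\<lambda>k. (real k + 1) powr (- \<theta>)). \<forall>k.
      prob_space.expectation M (\<lambda>\<omega>. f (x k \<omega>) - fstar)
        \<le> 2 * lam * d / (\<gamma> * l * (1 - \<eta>))
            * (G * \<alpha>bar + hbar\<^sup>2 * lam * d / 8 + hbar\<^sup>2 * lam\<^sup>2 * d\<^sup>2 * \<alpha>bar / (4 * l))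
            * (real k + 1) powr (- \<theta>) + r k)"
proof -
  note ABG = \<open>smoothness_ABG M S Z F lam A B G\<close>[unfolded smoothness_ABG_def Let_def, folded f_def, folded fstar_def]
  interpret M: prob_space M by fact
  interpret S: smooth_family S F lam
    using ABG \<open>\<And>y. F y \<in> borel_measurable S\<close> by unfold_locales auto
  interpret N: smooth_family "distr M S Z" F lam
    using ABG \<open>\<And>y. F y \<in> borel_measurable S\<close> by unfold_locales auto
  interpret N: prob_space "distr M S Z"
    by (rule M.prob_space_distr) fact
  have grad_sq_measurable: "(\<lambda>z. (norm (gradient (\<lambda>y. F y z) y))\<^sup>2) \<in> borel_measurable S" for y
    using S.grad_measurable[of y] unfolding S.grad_def[abs_def] by measurable
  have expectation_grad: "N.expectation (\<lambda>z. (norm (N.grad y z))\<^sup>2)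
      = M.expectation (\<lambda>\<omega>. (norm (gradient (\<lambda>y. F y (Z \<omega>)) y))\<^sup>2)" for y
    using \<open>Z \<in> measurable M S\<close> grad_sq_measurable
    by (subst integral_distr) (auto simp: N.grad_def)
  interpret N: smooth_stochastic "distr M S Z" F lam
  proof
    show "integrable (distr M S Z) (F y)" for y
      using ABG \<open>Z \<in> measurable M S\<close> \<open>\<And>y. F y \<in> borel_measurable S\<close> by (subst integrable_distr_eq) auto
    show "integrable (distr M S Z) (\<lambda>z. (norm (N.grad y z))\<^sup>2)" for y
      using ABG \<open>Z \<in> measurable M S\<close> grad_sq_measurable
      by (subst integrable_distr_eq) (auto simp: N.grad_def)
  qed
  have f_eq: "f = N.mean"
    using \<open>Z \<in> measurable M S\<close> \<open>\<And>y. F y \<in> borel_measurable S\<close>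
    by (auto simp: f_def objective_def N.mean_def integral_distr)
  obtain y0 where y0: "\<And>y. f y0 \<le> f y" using ABG by blast
  \<comment> \<open>A real infimum is informative only for a set bounded below; the attained minimum
    ensures this.\<close>
  then have "fstar = f y0"
    unfolding fstar_def by (intro cInf_eq_minimum) auto
  with y0 have fstar: "fstar \<le> N.mean y" for y by (simp add: f_eq)
  have lam: "0 < lam" and AB: "0 \<le> A" "0 \<le> B" using ABG by auto
  have \<gamma>: "0 < \<gamma>" and PL: "\<And>y. \<gamma> * (f y - fstar) \<le> (norm (gradient f y))\<^sup>2"
    using \<open>polyak_lojasiewicz f \<gamma>\<close> unfolding polyak_lojasiewicz_def fstar_def by auto
  have d: "0 < d" and l: "0 < l" by (auto simp: d_def l_def)
  have \<eta>: "0 \<le> \<eta>" "\<eta> < 1" "2 * \<alpha>bar * lam * d * (A + \<gamma> * B) = \<gamma> * l * \<eta>"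
  proof -
    \<comment> \<open>In the degenerate case \<open>\<eta> = 0\<close> and the step-size equation
      reads \<open>0 = 0\<close>, so both cases can be treated together.\<close>
    have "A + \<gamma> * B > 0 \<or> A = 0 \<and> B = 0"
      using AB \<gamma> by (smt (verit) mult_pos_pos mult_nonneg_nonneg)
    then show "0 \<le> \<eta>" "\<eta> < 1" "2 * \<alpha>bar * lam * d * (A + \<gamma> * B) = \<gamma> * l * \<eta>"
      using assms(19,20) by auto
  qed
  have pos: "0 < \<alpha>bar" "0 < hbar" by fact+
  interpret szd_process M S Z F lam Zs P \<alpha> h x0 "d / l" fstar
    by unfold_locales
      (use \<open>szd_sampling M S Z Zs P\<close> lam pos fstar in \<open>auto simp: d_def l_def \<alpha>_def h_def\<close>)
  define s where "s k = (real k + 1) powr - \<theta>" for k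
  define c where "c = \<alpha>bar * \<gamma> * (1 - \<eta>) / 2"
  define b where "b = lam * d / l * (G * \<alpha>bar\<^sup>2 + hbar\<^sup>2 * lam * d * \<alpha>bar / 8
      + hbar\<^sup>2 * lam\<^sup>2 * d\<^sup>2 * \<alpha>bar\<^sup>2 / (4 * l))"
  have s: "0 < s k" "s k \<le> 1" for k
    using powr_mono[of "- \<theta>" 0 "real k + 1"] \<open>1 / 2 < \<theta>\<close> by (auto simp: s_def)
  \<comment> \<open>The exponent \<open>- \<theta> / 2\<close> makes
    \<open>\<alpha> k * (h k)\<^sup>2\<close> of order \<open>(s k)\<^sup>2\<close>, matching the
    noise term.\<close>
  have h2: "(h k)\<^sup>2 = hbar\<^sup>2 * s k" for k
    by (simp add: h_def s_def power_mult_distrib power2_eq_square powr_add[symmetric])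
  have bound: "N.mean y - fstar - \<alpha> k / 2 * (norm (gradient N.mean y))\<^sup>2
      + lam * (\<alpha> k)\<^sup>2 * (d / l) * N.expectation (\<lambda>z. (norm (N.grad y z))\<^sup>2)
      + \<alpha> k * real CARD('l) * (lam * h k * (d / l))\<^sup>2 / 8
      + lam * (\<alpha> k)\<^sup>2 * (d / l) * real CARD('l) * (lam * h k * (d / l))\<^sup>2 / 4
      \<le> (1 - c * s k) * (N.mean y - fstar) + b * (s k)\<^sup>2" for k y
    unfolding c_def b_def expectation_grad l_def[symmetric] f_eq[symmetric]
    using ABG fstar[of y] AB \<gamma> lam l d pos s[of k] \<eta> PL[of y] h2[of k]
    by (intro PL_step_bound[of \<gamma> _ _ _ A B]) (auto simp: f_eq \<alpha>_def s_def)
  have int: "integrable M (\<lambda>\<omega>. N.mean (x k \<omega>) - fstar)" for k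
    unfolding x_def
  proof (induction k)
    case (Suc k)
    from expected_iterate_step(1)[OF this bound] show ?case .
  qed simp
  define u where "u k = M.expectation (\<lambda>\<omega>. N.mean (x k \<omega>) - fstar)" for k
  have s2: "(s k)\<^sup>2 = (real k + 1) powr (- 2 * \<theta>)" for k
    by (simp add: s_def power2_eq_square powr_add[symmetric])
  have "u (Suc k) \<le> (1 - c * (real k + 1) powr - \<theta>) * u k + b * (real k + 1) powr (- 2 * \<theta>)" for k
    using expected_iterate_step(2)[OF int[unfolded x_def] bound, of k]
    unfolding u_def x_def s2 unfolding s_def .
  moreover have "0 < c" using pos \<gamma> \<eta> by (simp add: c_def)
  moreover have "0 \<le> b"
    using ABG pos d l lam by (simp add: b_def)
  ultimately obtain r where r: "r \<in> o(\<lambda>k. (real k + 1) powr - \<theta>)"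
      "\<And>k. u k \<le> b / c * (real k + 1) powr - \<theta> + r k"
    using Chung_recurrence[of \<theta> c b u] \<open>1 / 2 < \<theta>\<close> \<open>\<theta> < 1\<close> by auto
  \<comment> \<open>One factor \<open>\<alpha>bar\<close> of \<open>b\<close> cancels against
    \<open>c\<close>, and the \<open>2\<close> comes from the half in \<open>c\<close>.\<close>
  have "b / c = 2 * lam * d / (\<gamma> * l * (1 - \<eta>))
      * (G * \<alpha>bar + hbar\<^sup>2 * lam * d / 8 + hbar\<^sup>2 * lam\<^sup>2 * d\<^sup>2 * \<alpha>bar / (4 * l))"
    using pos \<gamma> \<eta>(2) l by (simp add: b_def c_def field_simps power2_eq_square)
  with r int show ?thesis
    unfolding f_eq u_def by auto
qed

end
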